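(* Let $\mathcal{X}$ be a Banach space and let $A,B,C\in\mathcal{L}(\mathcal{X})$ be such that $B$ and $C$ are regular, $A$ is $(B,C)$-invertible and $A^{-(B,C)}\neq 0$. Suppose that $(A_n)_{n\in\mathbb{N}}$, $(B_n)_{n\in\mathbb{N}}$, $(C_n)_{n\in\mathbb{N}}\subset\mathcal{L}(\mathcal{X})$ are sequences such that for each $n\in\mathbb{N}$, $B_n$ and $C_n$ are regular and $A_n$ is $(B_n,C_n)$-invertible. If $(A_n)_{n\in\mathbb{N}}$ converges to $A$, then the following statements are equivalent. (i) $A_n^{-(B_n,C_n)}\to A^{-(B,C)}$. (ii) $A_n^{-(B_n,C_n)}A_n\to A^{-(B,C)}A$ and $A_nA_n^{-(B_n,C_n)}\to AA^{-(B,C)}$. (iii) $A_n^{-(B_n,C_n)}A_n\to A^{-(B,C)}A$ and $\widehat{\delta}(\mathcal{N}(C_n),\mathcal{N}(C))\to 0$. (iv) $A_nA_n^{-(B_n,C_n)}\to AA^{-(B,C)}$ and $\widehat{\delta}(\mathcal{R}(B_n),\mathcal{R}(B))\to 0$. (v) $\widehat{\delta}(\mathcal{R}(B_n),\mathcal{R}(B))\to 0$ and $\widehat{\delta}(\mathcal{N}(C_n),\mathcal{N}(C))\to 0$. (vi) $\widehat{\delta}(\mathcal{R}(A_n^{-(B_n,C_n)}),\mathcal{R}(A^{-(B,C)}))\to 0$ and $\widehat{\delta}(\mathcal{N}(A_n^{-(B_n,C_n)}),\mathcal{N}(A^{-(B,C)}))\to 0$. (All limits are as $n\to\infty$, operators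 converging in the operator norm.)
   Context: $\mathcal{L}(\mathcal{X})$ is the Banach algebra of bounded linear operators on $\mathcal{X}$; $\mathcal{R}(T)$, $\mathcal{N}(T)$ are the range and null space of $T$. An element $x$ of a unital algebra $\mathcal{A}$ is regular if $x=xyx$ for some $y\in\mathcal{A}$. For $b,c\in\mathcal{A}$, $a\in\mathcal{A}$ is $(b,c)$-invertible if there exists $y\in\mathcal{A}$ such that $y\in (b\mathcal{A}y)\cap(y\mathcal{A}c)$, $b=yab$ and $c=cay$; such $y$ is unique when it exists and is denoted $a^{-(b,c)}$ (here $\mathcal{A}=\mathcal{L}(\mathcal{X})$). For closed subspaces $\mathcal{M},\mathcal{N}$ of a Banach space, $\delta(\mathcal{M},\mathcal{N})=0$ if $\mathcal{M}=0$, otherwise $\delta(\mathcal{M},\mathcal{N})=\sup\{\mathrm{dist}(x,\mathcal{N}): x\in\mathcal{M},\|x\|=1\}$; the gap is $\widehat{\delta}(\mathcal{M},\mathcal{N})=\max\{\delta(\mathcal{M},\mathcal{N}),\delta(\mathcal{N},\mathcal{M})\}$. *)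

theory Defs
  imports "HOL-Analysis.Analysis"
begin

text \<open>
  The algebra of bounded operators on a Banach space is the type
  \<^typ>\<open>'a::banach \<Rightarrow>\<^sub>L 'a\<close>, with product \<^const>\<open>blinfun_compose\<close> and the
  operator norm. It is not a \<^class>\<open>ring_1\<close> instance, because the zero space is
  allowed; hence the algebraic notions below are stated for operators directly.
\<close>

definition regular_op :: "('a::banach \<Rightarrow>\<^sub>L 'a) \<Rightarrow> bool" where
  "regular_op X \<longleftrightarrow> (\<exists>Y. X = X o\<^sub>L Y o\<^sub>L X)"

definition is_bc_inverse ::
    "('a::banach \<Rightarrow>\<^sub>L 'a) \<Rightarrow> ('a \<Rightarrow>\<^sub>L 'a) \<Rightarrow> ('a \<Rightarrow>\<^sub>L 'a) \<Rightarrow> ('a \<Rightarrow>\<^sub>L 'a) \<Rightarrow> bool" where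
  "is_bc_inverse B C A Y \<longleftrightarrow>
     Y \<in> {B o\<^sub>L U o\<^sub>L Y |U. True} \<inter> {Y o\<^sub>L V o\<^sub>L C |V. True} \<and>
     B = Y o\<^sub>L A o\<^sub>L B \<and> C = C o\<^sub>L A o\<^sub>L Y"

definition bc_invertible ::
    "('a::banach \<Rightarrow>\<^sub>L 'a) \<Rightarrow> ('a \<Rightarrow>\<^sub>L 'a) \<Rightarrow> ('a \<Rightarrow>\<^sub>L 'a) \<Rightarrow> bool" where
  "bc_invertible B C A \<longleftrightarrow> (\<exists>Y. is_bc_inverse B C A Y)"

definition bc_inverse ::
    "('a::banach \<Rightarrow>\<^sub>L 'a) \<Rightarrow> ('a \<Rightarrow>\<^sub>L 'a) \<Rightarrow> ('a \<Rightarrow>\<^sub>L 'a) \<Rightarrow> ('a \<Rightarrow>\<^sub>L 'a)" where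
  "bc_inverse B C A = (THE Y. is_bc_inverse B C A Y)"

lemma blinfun_compose_assoc: "(S o\<^sub>L T) o\<^sub>L W = S o\<^sub>L (T o\<^sub>L W)"
  by (rule blinfun_eqI) simp

lemma is_bc_inverse_unique:
  assumes "is_bc_inverse B C A Y" and "is_bc_inverse B C A Z"
  shows "Y = Z"
proof -
  obtain V where V: "Y = Y o\<^sub>L V o\<^sub>L C"
    using assms(1) by (auto simp: is_bc_inverse_def)
  obtain U where U: "Z = B o\<^sub>L U o\<^sub>L Z"
    using assms(2) by (auto simp: is_bc_inverse_def)
  have B: "B = Y o\<^sub>L A o\<^sub>L B" and C: "C = C o\<^sub>L A o\<^sub>L Z"
    using assms by (auto simp: is_bc_inverse_def)
  have "Y = Y o\<^sub>L V o\<^sub>L (C o\<^sub>L A o\<^sub>L Z)"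
    using V C by simp
  also have "\<dots> = (Y o\<^sub>L V o\<^sub>L C) o\<^sub>L A o\<^sub>L Z"
    by (simp add: blinfun_compose_assoc)
  also have "\<dots> = Y o\<^sub>L A o\<^sub>L Z"
    using V by simp
  finally have 1: "Y = Y o\<^sub>L A o\<^sub>L Z" .
  have "Z = (Y o\<^sub>L A o\<^sub>L B) o\<^sub>L U o\<^sub>L Z"
    using U B by simp
  also have "\<dots> = Y o\<^sub>L A o\<^sub>L (B o\<^sub>L U o\<^sub>L Z)"
    by (simp add: blinfun_compose_assoc)
  also have "\<dots> = Y o\<^sub>L A o\<^sub>L Z"
    using U by simp
  finally show ?thesis
    using 1 by simp
qed

lemma is_bc_inverse_bc_inverse:
  assumes "bc_invertible B C A"
  shows "is_bc_inverse B C A (bc_inverse B C A)"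
  using assms is_bc_inverse_unique unfolding bc_invertible_def bc_inverse_def
  by (metis theI)

definition range_op :: "('a::banach \<Rightarrow>\<^sub>L 'a) \<Rightarrow> 'a set" where
  "range_op T = range (blinfun_apply T)"

definition null_op :: "('a::banach \<Rightarrow>\<^sub>L 'a) \<Rightarrow> 'a set" where
  "null_op T = {x. blinfun_apply T x = 0}"

text \<open>
  Meant for closed subspaces. The set of distances is then bounded above by 1, and it is
  nonempty whenever the first subspace is nonzero, so the real supremum is the genuine one.
\<close>

definition gap_delta :: "'a::banach set \<Rightarrow> 'a set \<Rightarrow> real" where
  "gap_delta M N = (if M = {0} then 0 else (SUP x\<in>{x \<in> M. norm x = 1}. infdist x N))"

definition gap :: "'a::banach set \<Rightarrow> 'a set \<Rightarrow> real" where
  "gap M N = max (gap_delta M N) (gap_delta N M)"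

end

theory Submission
  imports Defs
begin

text \<open>
  If \<open>Y\<close> is the \<open>(B, C)\<close>-inverse of \<open>A\<close>, then \<open>YAY = Y\<close>, and \<open>Y\<close> has the range of \<open>B\<close> and the null
  space of \<open>C\<close>; hence \<open>YA\<close> is a projection onto \<open>\<R>(B)\<close> and \<open>AY\<close> is a projection along \<open>\<N>(C)\<close>.
  Since the gap between ranges, or between null spaces, of two projections is at most the norm of
  their difference, (i) implies (ii), and (ii), (iii), (iv) each imply (v). For (v) implies (i),
  use \<open>Y' - Y = Y'(I - AY) - (I - Y'A')Y - Y'(A' - A)Y\<close>. Here \<open>I - AY\<close> maps into \<open>\<N>(Y)\<close>, which
  is close to the space \<open>\<N>(Y')\<close> killed by \<open>Y'\<close>, and \<open>Y\<close> maps into \<open>\<R>(Y)\<close>, which is close to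
  the space \<open>\<R>(Y')\<close> killed by \<open>I - Y'A'\<close>. This bounds \<open>\<parallel>Y' - Y\<parallel>\<close> by \<open>e \<parallel>Y'\<parallel> + f\<close> with \<open>e\<close> and
  \<open>f\<close> small, hence by \<open>(e \<parallel>Y\<parallel> + f) / (1 - e)\<close>.
\<close>

section \<open>Operator identities evaluated at vectors\<close>

lemma blinfun_compose_eqD:
  assumes "S o\<^sub>L T = W"
  shows "S (T x) = W x"
  using assms by (metis blinfun_apply_blinfun_compose)

lemma blinfun_compose3_eqD:
  assumes "S o\<^sub>L T o\<^sub>L R = W"
  shows "S (T (R x)) = W x"
  using blinfun_compose_eqD[OF assms, of x] by simp

section \<open>Gap estimates for subspaces and for operators vanishing on them\<close>

lemma bdd_above_infdist_unit:
  assumes "0 \<in> N"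
  shows "bdd_above ((\<lambda>x. infdist x N) ` {x \<in> M. norm x = 1})"
proof (rule bdd_aboveI2)
  show "infdist x N \<le> 1" if "x \<in> {x \<in> M. norm x = 1}" for x
    using infdist_le[OF assms, of x] that by simp
qed

text \<open>Ensures that for nonzero \<open>M\<close> the supremum in \<open>gap_delta M N\<close>
  runs over a nonempty set; a real supremum over the empty set would carry no information.\<close>

lemma subspace_unit_vector:
  fixes M :: "'a::real_normed_vector set"
  assumes "subspace M" "M \<noteq> {0}"
  obtains x where "x \<in> M" "norm x = 1"
proof -
  obtain y where "y \<in> M" "y \<noteq> 0"
    using assms subspace_0 by blast
  then show ?thesis
    using that[of "y /\<^sub>R norm y"] subspace_scale[OF assms(1)] by simp
qed

lemma gap_delta_nonneg:
  assumes "subspace M" "subspace N"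
  shows "0 \<le> gap_delta M N"
proof (cases "M = {0}")
  case False
  then obtain x where "x \<in> M" "norm x = 1"
    using subspace_unit_vector assms(1) by blast
  then have "infdist x N \<le> gap_delta M N"
    using False bdd_above_infdist_unit[OF subspace_0[OF assms(2)]]
    by (auto simp: gap_delta_def intro!: cSUP_upper)
  then show ?thesis
    using infdist_nonneg[of x N] by linarith
qed (simp add: gap_delta_def)

lemma gap_nonneg:
  assumes "subspace M" "subspace N"
  shows "0 \<le> gap M N"
  using gap_delta_nonneg[OF assms] by (simp add: gap_def)

text \<open>The condition \<open>0 \<le> k\<close> covers \<open>M = {0}\<close>, where
  \<open>gap_delta\<close> is 0 by convention and there is no unit vector to test.\<close>

lemma gap_delta_le:
  assumes "subspace M" "0 \<le> k" "\<And>x. x \<in> M \<Longrightarrow> norm x = 1 \<Longrightarrow> infdist x N \<le> k"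
  shows "gap_delta M N \<le> k"
proof (cases "M = {0}")
  case False
  then have "{x \<in> M. norm x = 1} \<noteq> {}"
    using subspace_unit_vector assms(1) by blast
  then show ?thesis
    using False assms(3) by (auto simp: gap_delta_def intro!: cSUP_least)
qed (simp add: gap_delta_def assms(2))

text \<open>For every \<open>z\<close> in \<open>N\<close>, \<open>T x = T (x - z)\<close> has norm
  at most \<open>norm T * dist x z\<close>; take the infimum over \<open>z\<close>.\<close>

lemma norm_le_infdist_null:
  assumes "N \<noteq> {}" "\<And>z. z \<in> N \<Longrightarrow> blinfun_apply T z = 0"
  shows "norm (T x) \<le> norm T * infdist x N"
proof (cases "T = 0")
  case False
  have "norm (T x) / norm T \<le> dist x z" if "z \<in> N" for z
  proof -
    have "T x = T (x - z)"
      using assms(2)[OF that] by (simp add: blinfun.diff_right)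
    then have "norm (T x) \<le> norm T * dist x z"
      by (simp add: norm_blinfun dist_norm)
    then show ?thesis
      using False by (simp add: field_simps)
  qed
  then have "norm (T x) / norm T \<le> infdist x N"
    using assms(1) by (auto simp: infdist_def intro!: cINF_greatest)
  then show ?thesis
    using False by (simp add: field_simps)
qed simp

lemma norm_le_gap_null:
  assumes "subspace M" "subspace N" "\<And>z. z \<in> N \<Longrightarrow> blinfun_apply T z = 0" "x \<in> M"
  shows "norm (T x) \<le> norm T * gap M N * norm x"
proof (cases "x = 0")
  case False
  define u where "u = x /\<^sub>R norm x"
  have u: "u \<in> {x \<in> M. norm x = 1}"
    using False assms(1,4) by (simp add: u_def subspace_scale)
  have "infdist u N \<le> gap_delta M N"
    using False assms(4) u bdd_above_infdist_unit[OF subspace_0[OF assms(2)]]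
    by (auto simp: gap_delta_def intro!: cSUP_upper)
  then have "infdist u N \<le> gap M N"
    by (simp add: gap_def)
  moreover have "norm (T u) \<le> norm T * infdist u N"
    using assms(2,3) subspace_0 by (intro norm_le_infdist_null) auto
  ultimately have "norm (T u) \<le> norm T * gap M N"
    by (meson mult_left_mono norm_ge_zero order_trans)
  then show ?thesis
    using False by (simp add: u_def blinfun.scaleR_right field_simps)
qed simp

text \<open>Serves to estimate a product whose right factor maps into one subspace while its left
  factor kills a nearby one.\<close>

lemma norm_compose_le_gap:
  assumes "subspace M" "subspace N"
    and "\<And>z. z \<in> N \<Longrightarrow> blinfun_apply T z = 0" "\<And>x. blinfun_apply S x \<in> M"
  shows "norm (T o\<^sub>L S) \<le> norm T * gap M N * norm S"
proof (rule norm_blinfun_bound)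
  fix x
  have "norm (T (S x)) \<le> norm T * gap M N * norm (S x)"
    by (rule norm_le_gap_null) (use assms in auto)
  also have "\<dots> \<le> norm T * gap M N * (norm S * norm x)"
    using gap_nonneg[OF assms(1,2)] by (intro mult_left_mono norm_blinfun) auto
  finally show "norm ((T o\<^sub>L S) x) \<le> norm T * gap M N * norm S * norm x"
    by (simp add: mult.assoc)
qed (use gap_nonneg[OF assms(1,2)] in auto)

section \<open>Gaps between ranges and between null spaces of projections\<close>

lemma subspace_range_op: "subspace (range_op T)"
  unfolding range_op_def
  by (intro linear_subspace_image subspace_UNIV blinfun.bounded_linear_right bounded_linear.linear)

lemma subspace_null_op: "subspace (null_op T)"
  unfolding null_op_def
  by (intro linear_subspace_kernel blinfun.bounded_linear_right bounded_linear.linear)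

text \<open>Idempotence gives \<open>P x = x\<close> on the range of \<open>P\<close>, so
  \<open>P' x\<close> is a point of the other range at distance
  \<open>norm ((P - P') x)\<close>.\<close>

lemma gap_delta_range_le:
  assumes "P o\<^sub>L P = P"
  shows "gap_delta (range_op P) (range_op P') \<le> norm (P - P')"
proof (rule gap_delta_le[OF subspace_range_op])
  fix x assume "x \<in> range_op P" and x: "norm x = 1"
  then obtain y where y: "x = P y"
    by (auto simp: range_op_def)
  have "P x = x"
    unfolding y by (rule blinfun_compose_eqD[OF assms])
  then have "dist x (P' x) = norm ((P - P') x)"
    by (simp add: dist_norm blinfun.diff_left)
  also have "\<dots> \<le> norm (P - P')"
    using norm_blinfun[of "P - P'" x] x by simp
  finally show "infdist x (range_op P') \<le> norm (P - P')"
    by (intro infdist_le2[of "P' x"]) (auto simp: range_op_def)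
qed simp

lemma gap_range_le:
  assumes "P o\<^sub>L P = P" "P' o\<^sub>L P' = P'"
  shows "gap (range_op P) (range_op P') \<le> norm (P - P')"
  using gap_delta_range_le[OF assms(1), of P'] gap_delta_range_le[OF assms(2), of P]
  by (simp add: gap_def norm_minus_commute)

text \<open>If \<open>Q x = 0\<close>, the nearby point is \<open>x - Q' x\<close>: it lies in the
  null space of \<open>Q'\<close> by idempotence, and its distance from \<open>x\<close> is
  \<open>norm ((Q - Q') x)\<close>.\<close>

lemma gap_delta_null_le:
  assumes "Q' o\<^sub>L Q' = Q'"
  shows "gap_delta (null_op Q) (null_op Q') \<le> norm (Q - Q')"
proof (rule gap_delta_le[OF subspace_null_op])
  fix x assume "x \<in> null_op Q" and x: "norm x = 1"
  then have "Q x = 0"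
    by (simp add: null_op_def)
  then have "dist x (x - Q' x) = norm ((Q - Q') x)"
    by (simp add: dist_norm blinfun.diff_left)
  also have "\<dots> \<le> norm (Q - Q')"
    using norm_blinfun[of "Q - Q'" x] x by simp
  finally have "dist x (x - Q' x) \<le> norm (Q - Q')" .
  moreover have "Q' (Q' x) = Q' x"
    by (rule blinfun_compose_eqD[OF assms])
  ultimately show "infdist x (null_op Q') \<le> norm (Q - Q')"
    by (intro infdist_le2[of "x - Q' x"]) (auto simp: null_op_def blinfun.diff_right)
qed simp

lemma gap_null_le:
  assumes "Q o\<^sub>L Q = Q" "Q' o\<^sub>L Q' = Q'"
  shows "gap (null_op Q) (null_op Q') \<le> norm (Q - Q')"
  using gap_delta_null_le[OF assms(2), of Q] gap_delta_null_le[OF assms(1), of Q']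
  by (simp add: gap_def norm_minus_commute)

lemma tendsto_gap_range:
  assumes "\<And>n. Pn n o\<^sub>L Pn n = Pn n" "P o\<^sub>L P = P" "Pn \<longlonglongrightarrow> P"
  shows "(\<lambda>n. gap (range_op (Pn n)) (range_op P)) \<longlonglongrightarrow> 0"
proof (rule tendsto_sandwich[OF _ _ tendsto_const])
  show "(\<lambda>n. norm (Pn n - P)) \<longlonglongrightarrow> 0"
    using assms(3) by (simp add: LIM_zero tendsto_norm_zero)
qed (intro always_eventually allI gap_range_le gap_nonneg subspace_range_op assms)+

lemma tendsto_gap_null:
  assumes "\<And>n. Qn n o\<^sub>L Qn n = Qn n" "Q o\<^sub>L Q = Q" "Qn \<longlonglongrightarrow> Q"
  shows "(\<lambda>n. gap (null_op (Qn n)) (null_op Q)) \<longlonglongrightarrow> 0"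
proof (rule tendsto_sandwich[OF _ _ tendsto_const])
  show "(\<lambda>n. norm (Qn n - Q)) \<longlonglongrightarrow> 0"
    using assms(3) by (simp add: LIM_zero tendsto_norm_zero)
qed (intro always_eventually allI gap_null_le gap_nonneg subspace_null_op assms)+

section \<open>The (B,C)-inverse as an outer inverse, and its projections\<close>

lemma is_bc_inverse_outer:
  assumes "is_bc_inverse B C A Y"
  shows "Y o\<^sub>L A o\<^sub>L Y = Y"
proof -
  obtain U where U: "Y = B o\<^sub>L U o\<^sub>L Y"
    using assms by (auto simp: is_bc_inverse_def)
  have B: "B = Y o\<^sub>L A o\<^sub>L B"
    using assms by (simp add: is_bc_inverse_def)
  \<comment> \<open>After regrouping, \<open>YAB\<close> collapses to \<open>B\<close>, and then
    \<open>BUY\<close> to \<open>Y\<close>.\<close>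
  have "Y o\<^sub>L A o\<^sub>L (B o\<^sub>L U o\<^sub>L Y) = (Y o\<^sub>L A o\<^sub>L B) o\<^sub>L U o\<^sub>L Y"
    by (simp add: blinfun_compose_assoc)
  then show ?thesis
    unfolding U[symmetric] B[symmetric] .
qed

text \<open>The factorisations \<open>Y = BUY\<close> and \<open>B = YAB\<close> give the two
  inclusions.\<close>

lemma is_bc_inverse_range:
  assumes "is_bc_inverse B C A Y"
  shows "range_op Y = range_op B"
proof -
  obtain U where U: "Y = B o\<^sub>L U o\<^sub>L Y"
    using assms by (auto simp: is_bc_inverse_def)
  have B: "B = Y o\<^sub>L A o\<^sub>L B"
    using assms by (simp add: is_bc_inverse_def)
  show ?thesis
  proof
    show "range_op Y \<subseteq> range_op B"
      using blinfun_compose3_eqD[OF U[symmetric], symmetric] unfolding range_op_def by blast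
    show "range_op B \<subseteq> range_op Y"
      using blinfun_compose3_eqD[OF B[symmetric], symmetric] unfolding range_op_def by blast
  qed
qed

text \<open>By \<open>Y = YVC\<close> and \<open>C = CAY\<close>, each of \<open>Y\<close> and
  \<open>C\<close> factors through the other on the right.\<close>

lemma is_bc_inverse_null:
  assumes "is_bc_inverse B C A Y"
  shows "null_op Y = null_op C"
proof -
  obtain V where V: "Y = Y o\<^sub>L V o\<^sub>L C"
    using assms by (auto simp: is_bc_inverse_def)
  have C: "C = C o\<^sub>L A o\<^sub>L Y"
    using assms by (simp add: is_bc_inverse_def)
  have "Y x = 0 \<longleftrightarrow> C x = 0" for x
    using blinfun_compose3_eqD[OF V[symmetric], of x] blinfun_compose3_eqD[OF C[symmetric], of x]
    by auto
  then show ?thesis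
    by (simp add: null_op_def)
qed

lemma outer_inverse_projections:
  assumes "Y o\<^sub>L A o\<^sub>L Y = Y"
  shows "(Y o\<^sub>L A) o\<^sub>L (Y o\<^sub>L A) = Y o\<^sub>L A" "(A o\<^sub>L Y) o\<^sub>L (A o\<^sub>L Y) = A o\<^sub>L Y"
  by (rule blinfun_eqI, simp add: blinfun_compose3_eqD[OF assms])+

lemma outer_inverse_range:
  assumes "Y o\<^sub>L A o\<^sub>L Y = Y"
  shows "range_op (Y o\<^sub>L A) = range_op Y"
proof
  show "range_op Y \<subseteq> range_op (Y o\<^sub>L A)"
    using blinfun_compose3_eqD[OF assms, symmetric] by (auto simp: range_op_def)
qed (auto simp: range_op_def)

text \<open>Applying \<open>Y\<close> recovers \<open>Y x\<close> from \<open>A (Y x)\<close>, so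
  \<open>A\<close> is injective on the range of \<open>Y\<close>.\<close>

lemma outer_inverse_null:
  assumes "Y o\<^sub>L A o\<^sub>L Y = Y"
  shows "null_op (A o\<^sub>L Y) = null_op Y"
proof -
  have "A (Y x) = 0 \<longleftrightarrow> Y x = 0" for x
    using blinfun_compose3_eqD[OF assms, of x] by auto
  then show ?thesis
    by (simp add: null_op_def)
qed

section \<open>Perturbation of outer inverses\<close>

lemma outer_inverse_diff_bound:
  assumes "Y o\<^sub>L A o\<^sub>L Y = Y" "Y' o\<^sub>L A' o\<^sub>L Y' = Y'"
  defines "r \<equiv> gap (range_op Y) (range_op Y')" and "k \<equiv> gap (null_op Y) (null_op Y')"
  shows "norm (Y' - Y) \<le>
    norm Y' * (k * norm (id_blinfun - (A o\<^sub>L Y)) + norm A' * r * norm Y + norm (A' - A) * norm Y)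
      + r * norm Y"
proof -
  let ?I = "id_blinfun :: 'a \<Rightarrow>\<^sub>L 'a"
  have YAY: "Y (A (Y x)) = Y x" "Y' (A' (Y' x)) = Y' x" for x
    by (rule blinfun_compose3_eqD[OF assms(1)]) (rule blinfun_compose3_eqD[OF assms(2)])
  have r: "0 \<le> r"
    unfolding r_def by (intro gap_nonneg subspace_range_op)
  \<comment> \<open>On expansion the terms \<open>Y'AY\<close> and \<open>Y'A'Y\<close> each occur
    with both signs and cancel.\<close>
  have "Y' - Y = (Y' o\<^sub>L (?I - (A o\<^sub>L Y))) - ((?I - (Y' o\<^sub>L A')) o\<^sub>L Y) - (Y' o\<^sub>L (A' - A) o\<^sub>L Y)"
    by (rule blinfun_eqI) (simp add: blinfun.diff_left blinfun.diff_right)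
  then have "norm (Y' - Y) \<le> norm (Y' o\<^sub>L (?I - (A o\<^sub>L Y))) + norm ((?I - (Y' o\<^sub>L A')) o\<^sub>L Y)
      + norm (Y' o\<^sub>L (A' - A) o\<^sub>L Y)"
    by (auto intro!: norm_triangle_le_diff)
  moreover have "norm (Y' o\<^sub>L (?I - (A o\<^sub>L Y))) \<le> norm Y' * k * norm (?I - (A o\<^sub>L Y))"
    unfolding k_def
    by (intro norm_compose_le_gap subspace_null_op)
      (auto simp: null_op_def blinfun.diff_left blinfun.diff_right YAY)
  moreover have "norm ((?I - (Y' o\<^sub>L A')) o\<^sub>L Y) \<le> (1 + norm Y' * norm A') * r * norm Y"
  proof -
    \<comment> \<open>The identity has norm at most 1, with value 0 on the zero space.\<close>
    have "norm (?I - (Y' o\<^sub>L A')) \<le> 1 + norm Y' * norm A'"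
      by (intro norm_triangle_le_diff add_mono norm_blinfun_id_le norm_blinfun_compose)
    moreover have "norm ((?I - (Y' o\<^sub>L A')) o\<^sub>L Y) \<le> norm (?I - (Y' o\<^sub>L A')) * r * norm Y"
      unfolding r_def
      by (intro norm_compose_le_gap subspace_range_op)
        (auto simp: range_op_def blinfun.diff_left YAY)
    ultimately show ?thesis
      using r by (meson mult_right_mono norm_ge_zero order_trans)
  qed
  moreover have "norm (Y' o\<^sub>L (A' - A) o\<^sub>L Y) \<le> norm Y' * norm (A' - A) * norm Y"
    by (meson mult_right_mono norm_blinfun_compose norm_ge_zero order_trans)
  ultimately show ?thesis
    by (simp add: algebra_simps)
qed

lemma gap_commute: "gap M N = gap N M"
  by (simp add: gap_def max.commute)

lemma tendsto_outer_inverse: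
  assumes Y: "Y o\<^sub>L A o\<^sub>L Y = Y" and Yn: "\<And>n. Yn n o\<^sub>L An n o\<^sub>L Yn n = Yn n"
    and A: "An \<longlonglongrightarrow> A"
    and r: "(\<lambda>n. gap (range_op (Yn n)) (range_op Y)) \<longlonglongrightarrow> 0"
    and k: "(\<lambda>n. gap (null_op (Yn n)) (null_op Y)) \<longlonglongrightarrow> 0"
  shows "Yn \<longlonglongrightarrow> Y"
proof -
  \<comment> \<open>The bound is split as \<open>norm (Yn n) * e n + f n\<close>: \<open>e\<close>
    collects the coefficient of the norm of the varying inverse, \<open>f\<close> the
    remainder.\<close>
  define e where "e n = gap (null_op Y) (null_op (Yn n)) * norm (id_blinfun - (A o\<^sub>L Y))
    + norm (An n) * gap (range_op Y) (range_op (Yn n)) * norm Y + norm (An n - A) * norm Y" for n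
  define f where "f n = gap (range_op Y) (range_op (Yn n)) * norm Y" for n
  note r' = r[unfolded gap_commute[of _ "range_op Y"]] and k' = k[unfolded gap_commute[of _ "null_op Y"]]
  have "e \<longlonglongrightarrow> 0 * norm (id_blinfun - (A o\<^sub>L Y)) + norm A * 0 * norm Y + norm (A - A) * norm Y"
    unfolding e_def by (intro tendsto_intros r' k' A)
  then have e0: "e \<longlonglongrightarrow> 0"
    by simp
  have "f \<longlonglongrightarrow> 0 * norm Y"
    unfolding f_def by (intro tendsto_intros r')
  then have f0: "f \<longlonglongrightarrow> 0"
    by simp
  have e_nonneg: "0 \<le> e n" for n
    unfolding e_def by (simp add: gap_nonneg subspace_null_op subspace_range_op)
  have "\<forall>\<^sub>F n in sequentially. e n < 1"
    using e0 by (rule order_tendstoD) simp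
  then have "\<forall>\<^sub>F n in sequentially. norm (Yn n - Y) \<le> (e n * norm Y + f n) / (1 - e n)"
  proof eventually_elim
    case (elim n)
    have "norm (Yn n - Y) \<le> norm (Yn n) * e n + f n"
      using outer_inverse_diff_bound[OF Y Yn] unfolding e_def f_def .
    \<comment> \<open>Boundedness of \<open>Yn\<close> is not known beforehand. The triangle
      inequality puts \<open>norm (Yn n - Y)\<close> on both sides, and \<open>e n < 1\<close>
      allows solving for it.\<close>
    also have "\<dots> \<le> (norm Y + norm (Yn n - Y)) * e n + f n"
      using e_nonneg norm_triangle_sub[of "Yn n" Y] by (simp add: mult_right_mono)
    finally show ?case
      using elim by (simp add: field_simps)
  qed
  moreover have "(\<lambda>n. (e n * norm Y + f n) / (1 - e n)) \<longlonglongrightarrow> (0 * norm Y + 0) / (1 - 0)"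
    by (intro tendsto_intros e0 f0) simp
  ultimately have "(\<lambda>n. Yn n - Y) \<longlonglongrightarrow> 0"
    by (simp add: Lim_null_comparison)
  then show ?thesis
    by (rule LIM_zero_cancel)
qed

section \<open>Equivalence of the six convergence conditions\<close>

theorem theorem5p2:
  fixes A B C :: "'a::banach \<Rightarrow>\<^sub>L 'a"
    and An Bn Cn :: "nat \<Rightarrow> ('a \<Rightarrow>\<^sub>L 'a)"
  assumes "regular_op B" and "regular_op C"
    and "bc_invertible B C A"
    and "bc_inverse B C A \<noteq> 0"
    and "\<And>n. regular_op (Bn n)" and "\<And>n. regular_op (Cn n)"
    and "\<And>n. bc_invertible (Bn n) (Cn n) (An n)"
    and "An \<longlonglongrightarrow> A"
  shows
    "let Y = bc_inverse B C A;
         Yn = (\<lambda>n. bc_inverse (Bn n) (Cn n) (An n));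
         i = (Yn \<longlonglongrightarrow> Y);
         ii = ((\<lambda>n. Yn n o\<^sub>L An n) \<longlonglongrightarrow> (Y o\<^sub>L A) \<and> (\<lambda>n. An n o\<^sub>L Yn n) \<longlonglongrightarrow> (A o\<^sub>L Y));
         iii = ((\<lambda>n. Yn n o\<^sub>L An n) \<longlonglongrightarrow> (Y o\<^sub>L A) \<and>
                (\<lambda>n. gap (null_op (Cn n)) (null_op C)) \<longlonglongrightarrow> 0);
         iv = ((\<lambda>n. An n o\<^sub>L Yn n) \<longlonglongrightarrow> (A o\<^sub>L Y) \<and>
               (\<lambda>n. gap (range_op (Bn n)) (range_op B)) \<longlonglongrightarrow> 0);
         v = ((\<lambda>n. gap (range_op (Bn n)) (range_op B)) \<longlonglongrightarrow> 0 \<and>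
              (\<lambda>n. gap (null_op (Cn n)) (null_op C)) \<longlonglongrightarrow> 0);
         vi = ((\<lambda>n. gap (range_op (Yn n)) (range_op Y)) \<longlonglongrightarrow> 0 \<and>
               (\<lambda>n. gap (null_op (Yn n)) (null_op Y)) \<longlonglongrightarrow> 0)
     in (i \<longleftrightarrow> ii) \<and> (i \<longleftrightarrow> iii) \<and> (i \<longleftrightarrow> iv) \<and> (i \<longleftrightarrow> v) \<and> (i \<longleftrightarrow> vi)"
proof -
  define Y where "Y = bc_inverse B C A"
  define Yn where "Yn n = bc_inverse (Bn n) (Cn n) (An n)" for n
  have inv: "is_bc_inverse B C A Y" and invn: "\<And>n. is_bc_inverse (Bn n) (Cn n) (An n) (Yn n)"
    unfolding Y_def Yn_def by (intro is_bc_inverse_bc_inverse assms)+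
  note outer = is_bc_inverse_outer[OF inv] and outern = is_bc_inverse_outer[OF invn]
  note range = is_bc_inverse_range[OF inv] is_bc_inverse_range[OF invn]
  note null = is_bc_inverse_null[OF inv] is_bc_inverse_null[OF invn]
  note P = outer_inverse_projections[OF outer] and Pn = outer_inverse_projections[OF outern]
  define gR gN where "gR = (\<lambda>n. gap (range_op (Bn n)) (range_op B))"
    and "gN = (\<lambda>n. gap (null_op (Cn n)) (null_op C))"
  have i: "(\<lambda>n. Yn n o\<^sub>L An n) \<longlonglongrightarrow> (Y o\<^sub>L A)" "(\<lambda>n. An n o\<^sub>L Yn n) \<longlonglongrightarrow> (A o\<^sub>L Y)" if "Yn \<longlonglongrightarrow> Y"
    using that assms(8)
    by (auto intro: bounded_bilinear.tendsto[OF bounded_bilinear_blinfun_compose])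
  \<comment> \<open>\<open>YA\<close> is a projection with the range of \<open>Y\<close>, hence of
    \<open>B\<close>; the same holds along the sequence.\<close>
  have R: "gR \<longlonglongrightarrow> 0" if "(\<lambda>n. Yn n o\<^sub>L An n) \<longlonglongrightarrow> (Y o\<^sub>L A)"
    using tendsto_gap_range[OF Pn(1) P(1) that]
    by (simp add: gR_def outer_inverse_range outer outern range)
  \<comment> \<open>Dually, \<open>AY\<close> is a projection with the null space of
    \<open>Y\<close>, hence of \<open>C\<close>.\<close>
  have N: "gN \<longlonglongrightarrow> 0" if "(\<lambda>n. An n o\<^sub>L Yn n) \<longlonglongrightarrow> (A o\<^sub>L Y)"
    using tendsto_gap_null[OF Pn(2) P(2) that]
    by (simp add: gN_def outer_inverse_null outer outern null)
  have v: "Yn \<longlonglongrightarrow> Y" if "gR \<longlonglongrightarrow> 0" "gN \<longlonglongrightarrow> 0"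
    using that tendsto_outer_inverse[OF outer outern assms(8)]
    by (simp add: gR_def gN_def range null)
  \<comment> \<open>Rewriting with \<open>range\<close> and \<open>null\<close> turns (vi) into (v).
    From (i) follows (ii), and with \<open>R\<close> and \<open>N\<close> also (iii), (iv) and (v);
    conversely \<open>R\<close> and \<open>N\<close> reduce (ii), (iii) and (iv) to (v), which
    yields (i) by \<open>v\<close>.\<close>
  show ?thesis
    unfolding Let_def Y_def[symmetric] Yn_def[symmetric] range null
      gR_def[symmetric] gN_def[symmetric]
    using i R N v by blast
qed

end
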